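(* Consider an instance of the Lovász Local Lemma in which every random variable affects at most $3$ bad events, and which satisfies the criterion $p\cdot 2^{d} < 1$. Then there is a sequential and local deterministic process that computes an assignment to the random variables under which none of the bad events occurs.
   Context: An instance of the (symmetric) Lovász Local Lemma (LLL) consists of a finite set of mutually independent random variables, each with a finite discrete range, and a finite set of bad events $\mathcal{E}_1,\dots,\mathcal{E}_n$, each determined by the values of some of the variables; a variable affects an event if the event depends on it. The dependency graph has the events as nodes, two adjacent iff they depend on a common variable; $d$ is its maximum degree and $p$ is an upper bound on $\Pr[\mathcal{E}_i]$ for all $i$. The process fixes the random variables one at a time to concrete values (never changed afterwards), in an arbitrary order; "local" means the value chosen for a variable depends only on the current state of the radius-$1$ neighborhood (in the dependency graph) of the events that variable affects, so that variables that do not affect a common event may be fixed simultaneously. *)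

theory Defs
  imports "HOL-Probability.Probability"
begin

(* The random variables x in vars have laws (dist x) with finite support set_pmf (dist x), which is
   the range of x; all ranges are embedded in one type 'v.  The event e is determined by the
   variables in (vbl e): it is given as the set (bad e) of those tuples of values, i.e. extensional
   functions on (vbl e), for which it occurs.  Any such declared scope is allowed, in particular
   the minimal one, consisting of exactly those variables on which the event really depends. *)
record ('x, 'v, 'e) lll =
  vars :: "'x set"
  dist :: "'x \<Rightarrow> 'v pmf"
  events :: "'e set"
  vbl :: "'e \<Rightarrow> 'x set"
  bad :: "'e \<Rightarrow> ('x \<Rightarrow> 'v) set"

definition lll_instance :: "('x, 'v, 'e) lll \<Rightarrow> bool" where
  "lll_instance I \<longleftrightarrow>
     finite (vars I) \<and> (\<forall>x\<in>vars I. finite (set_pmf (dist I x))) \<and> finite (events I) \<and>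
     (\<forall>e\<in>events I. vbl I e \<subseteq> vars I \<and> bad I e \<subseteq> (\<Pi>\<^sub>E x\<in>vbl I e. set_pmf (dist I x)))"

definition occurs :: "('x, 'v, 'e) lll \<Rightarrow> 'e \<Rightarrow> ('x \<Rightarrow> 'v) \<Rightarrow> bool" where
  "occurs I e \<sigma> \<longleftrightarrow> restrict \<sigma> (vbl I e) \<in> bad I e"

(* Pi_pmf is the joint law of mutually independent variables with the given marginal laws. *)
definition event_prob :: "('x, 'v, 'e) lll \<Rightarrow> 'e \<Rightarrow> real" where
  "event_prob I e =
     measure_pmf.prob (Pi_pmf (vars I) undefined (dist I)) {\<sigma>. occurs I e \<sigma>}"

definition affected :: "('x, 'v, 'e) lll \<Rightarrow> 'x \<Rightarrow> 'e set" where
  "affected I x = {e \<in> events I. x \<in> vbl I e}"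

definition neighbors :: "('x, 'v, 'e) lll \<Rightarrow> 'e \<Rightarrow> 'e set" where
  "neighbors I e = {f \<in> events I. f \<noteq> e \<and> vbl I e \<inter> vbl I f \<noteq> {}}"

(* The inserted 0 only matters if there are no events. *)
definition max_degree :: "('x, 'v, 'e) lll \<Rightarrow> nat" where
  "max_degree I = Max (insert 0 ((\<lambda>e. card (neighbors I e)) ` events I))"

(* Besides the partial assignment of the variables, every event keeps bookkeeping data of type 'm. *)
record ('x, 'v, 'e, 'm) state =
  val :: "'x \<Rightarrow> 'v option"
  mem :: "'e \<Rightarrow> 'm"

(* A process is one rule for all instances.  Given the instance, the current state and the variable
   to be fixed, it yields the value of the variable and new data for the affected events. *)
record ('x, 'v, 'e, 'm) process =
  init :: "'m"
  rule :: "('x, 'v, 'e) lll \<Rightarrow> ('x, 'v, 'e, 'm) state \<Rightarrow> 'x \<Rightarrow> 'v \<times> ('e \<Rightarrow> 'm)"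

definition step ::
  "('x, 'v, 'e, 'm) process \<Rightarrow> ('x, 'v, 'e) lll \<Rightarrow> 'x \<Rightarrow>
     ('x, 'v, 'e, 'm) state \<Rightarrow> ('x, 'v, 'e, 'm) state" where
  "step P I x s =
     (let (v, m) = rule P I s x
      in \<lparr>val = (val s)(x \<mapsto> v), mem = (\<lambda>e. if e \<in> affected I x then m e else mem s e)\<rparr>)"

definition init_state :: "('x, 'v, 'e, 'm) process \<Rightarrow> ('x, 'v, 'e, 'm) state" where
  "init_state P = \<lparr>val = Map.empty, mem = (\<lambda>_. init P)\<rparr>"

definition run ::
  "('x, 'v, 'e, 'm) process \<Rightarrow> ('x, 'v, 'e) lll \<Rightarrow> 'x list \<Rightarrow> ('x, 'v, 'e, 'm) state" where
  "run P I xs = fold (step P I) xs (init_state P)"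

definition nbhd :: "('x, 'v, 'e) lll \<Rightarrow> 'x \<Rightarrow> 'e set" where
  "nbhd I x = affected I x \<union> (\<Union>e\<in>affected I x. neighbors I e)"

(* The part of the instance and of the state that is visible when x is fixed: the events in the
   radius-1 neighborhood of the events affected by x, and the variables of these events.  The
   variable x is inserted because it may affect no event at all. *)
definition view ::
  "('x, 'v, 'e) lll \<Rightarrow> ('x, 'v, 'e, 'm) state \<Rightarrow> 'x \<Rightarrow>
     ('x, 'v, 'e) lll \<times> ('x, 'v, 'e, 'm) state" where
  "view I s x =
     (let F = nbhd I x; X = insert x (\<Union>e\<in>F. vbl I e)
      in (\<lparr>vars = X, dist = restrict (dist I) X, events = F,
           vbl = restrict (vbl I) F, bad = restrict (bad I) F\<rparr>,
          \<lparr>val = val s |` X, mem = restrict (mem s) F\<rparr>))"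

(* The first conjunct ranges over two instances, since a rule that may depend on the instance in an
   arbitrary way could simply look up a good assignment.  The second conjunct says that variables
   without a common event may be fixed simultaneously: neither decision depends on whether the
   other variable has been fixed before. *)
definition local_process :: "('x, 'v, 'e, 'm) process \<Rightarrow> bool" where
  "local_process P \<longleftrightarrow>
     (\<forall>I J s t x. lll_instance I \<longrightarrow> lll_instance J \<longrightarrow> x \<in> vars I \<longrightarrow> x \<in> vars J \<longrightarrow>
        view I s x = view J t x \<longrightarrow> rule P I s x = rule P J t x) \<and>
     (\<forall>I s x y. lll_instance I \<longrightarrow> x \<in> vars I \<longrightarrow> y \<in> vars I \<longrightarrow> x \<noteq> y \<longrightarrow>
        affected I x \<inter> affected I y = {} \<longrightarrow> rule P I (step P I y s) x = rule P I s x)"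

definition solves :: "('x, 'v, 'e, 'm) process \<Rightarrow> ('x, 'v, 'e) lll \<Rightarrow> bool" where
  "solves P I \<longleftrightarrow>
     (\<forall>xs. distinct xs \<longrightarrow> set xs = vars I \<longrightarrow>
        (\<exists>\<sigma>. (\<forall>x\<in>vars I. val (run P I xs) x = Some (\<sigma> x) \<and> \<sigma> x \<in> set_pmf (dist I x)) \<and>
             (\<forall>e\<in>events I. \<not> occurs I e \<sigma>)))"

end

theory Submission
  imports Defs
begin

text \<open>
  Every edge of the dependency graph carries two nonnegative weights, one per endpoint, whose sum is
  at most \<open>2\<close>; the weights are initially \<open>1\<close>.  The conditional probability of an event never
  exceeds its initial probability times the product of the weights at it, hence stays below
  \<open>p * 2 ^ d < 1\<close>; once everything is fixed it is \<open>0\<close> or \<open>1\<close>, so it is \<open>0\<close>.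

  Fixing a variable of three events \<open>d, e, f\<close> multiplies their conditional probabilities by factors
  of mean at most \<open>1\<close>, and the six weights on the triangle must absorb the factors of some value.
  Up to a factor \<open>4\<close>, the weight products at the three corners range over the triples \<open>(a, b, c)\<close>
  with \<open>arcsin \<surd>a + arcsin \<surd>b + arcsin \<surd>c \<le> \<pi> / 2\<close>.  At each boundary point of this set there is a
  plane with nonnegative coefficients such that all nonnegative triples below it belong to the set:
  this is the inequality \<open>2 (q r cos x + r p cos y + p q cos z) \<le> p\<^sup>2 + q\<^sup>2 + r\<^sup>2\<close> for the angles of a
  triangle.  By averaging, some value of the variable yields a triple below the plane.
\<close>

section \<open>Products of edge shares at the corners of a triangle\<close>

text \<open>
  Each of \<open>u, v, w\<close> splits one edge of a triangle; \<open>a, b, c\<close> bound the products at its corners.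
\<close>
definition rep :: "real \<Rightarrow> real \<Rightarrow> real \<Rightarrow> bool" where
  "rep a b c \<longleftrightarrow> (\<exists>u\<in>{0..1}. \<exists>v\<in>{0..1}. \<exists>w\<in>{0..1}.
     a \<le> u * (1 - v) \<and> b \<le> v * (1 - w) \<and> c \<le> w * (1 - u))"

lemma repI:
  assumes "u \<in> {0..1}" "v \<in> {0..1}" "w \<in> {0..1}"
    and "a \<le> u * (1 - v)" "b \<le> v * (1 - w)" "c \<le> w * (1 - u)"
  shows "rep a b c"
  using assms unfolding rep_def by blast

lemma rep_cyclic: "rep a b c \<Longrightarrow> rep b c a"
  unfolding rep_def by blast

section \<open>Trigonometric inequalities behind the tangent planes\<close>

text \<open>The difference of the two sides is the squared modulus of the complex number
  \<open>p - q * exp (- i * z) - r * exp (i * y)\<close>, since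
  \<open>cos (y + z) = - cos x\<close>.\<close>

lemma triangle_quadratic_form:
  fixes x y z p q r :: real
  assumes "x + y + z = pi"
  shows "2 * (q * r * cos x + r * p * cos y + p * q * cos z) \<le> p\<^sup>2 + q\<^sup>2 + r\<^sup>2"
proof -
  have x: "cos x = sin y * sin z - cos y * cos z"
  proof -
    have "x = pi - (y + z)" using assms by simp
    then show ?thesis by (simp only: cos_pi_minus cos_add minus_diff_eq)
  qed
  have "0 \<le> (p - q * cos z - r * cos y)\<^sup>2 + (q * sin z - r * sin y)\<^sup>2"
    by simp
  also have "\<dots> = p\<^sup>2 + q\<^sup>2 * ((cos z)\<^sup>2 + (sin z)\<^sup>2) + r\<^sup>2 * ((cos y)\<^sup>2 + (sin y)\<^sup>2)
      - 2 * (q * r * (sin y * sin z - cos y * cos z) + r * p * cos y + p * q * cos z)"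
    by algebra
  also have "\<dots> = p\<^sup>2 + q\<^sup>2 + r\<^sup>2 - 2 * (q * r * cos x + r * p * cos y + p * q * cos z)"
    by (simp only: x sin_cos_squared_add2 mult_1_right)
  finally show ?thesis by simp
qed

text \<open>This is the sum of the three laws of cosines in a triangle whose sides are the sines of
  the opposite angles. It is an equality case of \<open>triangle_quadratic_form\<close>, which makes
  the plane in \<open>tangent_plane\<close> touch at the chosen point.\<close>

lemma triangle_law_of_cosines:
  fixes a b c :: real
  assumes "a + b + c = pi"
  shows "2 * (sin b * sin c * cos a + sin c * sin a * cos b + sin a * sin b * cos c)
    = (sin a)\<^sup>2 + (sin b)\<^sup>2 + (sin c)\<^sup>2"
proof -
  have s: "sin x = sin y * cos z + cos y * sin z" if "x + y + z = pi" for x y z :: real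
  proof -
    have "x = pi - (y + z)" using that by simp
    then show ?thesis by (simp only: sin_pi_minus sin_add)
  qed
  have "(sin a)\<^sup>2 = sin a * (sin b * cos c + cos b * sin c)"
       "(sin b)\<^sup>2 = sin b * (sin c * cos a + cos c * sin a)"
       "(sin c)\<^sup>2 = sin c * (sin a * cos b + cos a * sin b)"
    using s[of a b c] s[of b c a] s[of c a b] assms unfolding power2_eq_square
    by (metis add.commute add.left_commute)+
  then show ?thesis by (simp add: algebra_simps)
qed

text \<open>
  The coefficients come from the gradient: at \<open>s = (sin a)\<^sup>2\<close> the derivative of \<open>arcsin \<surd>s\<close> is
  \<open>1 / sin (2 * a)\<close>.
\<close>
lemma tangent_plane:
  fixes a b c x y z :: real
  assumes "a + b + c = pi / 2" "x + y + z = pi / 2"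
  defines "k \<equiv> sin (2 * b) * sin (2 * c)" and "l \<equiv> sin (2 * c) * sin (2 * a)"
    and "m \<equiv> sin (2 * a) * sin (2 * b)"
  shows "k * (sin a)\<^sup>2 + l * (sin b)\<^sup>2 + m * (sin c)\<^sup>2
    \<le> k * (sin x)\<^sup>2 + l * (sin y)\<^sup>2 + m * (sin z)\<^sup>2"
proof -
  have sq: "(sin t)\<^sup>2 = (1 - cos (2 * t)) / 2" for t :: real
    by (simp add: cos_double_sin)
  \<comment> \<open>Instantiation follows the order of occurrence, so the three sines replace
    \<open>q\<close>, \<open>r\<close>, \<open>p\<close>. The resulting upper bound is a sum of
    squared sines, which the law of cosines turns into the value at \<open>a\<close>,
    \<open>b\<close>, \<open>c\<close>.\<close>
  have "2 * (k * cos (2*x) + l * cos (2*y) + m * cos (2*z))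
      \<le> 2 * (k * cos (2*a) + l * cos (2*b) + m * cos (2*c))"
    using triangle_quadratic_form[of "2*x" "2*y" "2*z" "sin (2*b)" "sin (2*c)" "sin (2*a)"]
      triangle_law_of_cosines[of "2*a" "2*b" "2*c"] assms(1,2)
    unfolding k_def l_def m_def by simp
  then show ?thesis unfolding sq by (simp add: field_simps)
qed


section \<open>Describing the representable triples by angles\<close>

text \<open>A corner with demand zero can cede both its edges to the other corners, which then only
  share the edge split by \<open>w\<close>.\<close>

lemma rep_degenerate:
  assumes "b + c \<le> 1" "0 \<le> c" "c \<le> 1"
  shows "rep 0 b c"
  using assms by (intro repI[of 0 1 c]) auto

text \<open>Since \<open>cos y = sin (x + z) = sin x * cos z + cos x * sin z\<close>, dividing by
  \<open>cos y\<close> splits one edge into two shares, and likewise for the other two. In the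
  corner products all cosines cancel. A right angle makes a denominator vanish, but then the other
  two angles are zero and the triple is degenerate.\<close>

lemma rep_sin:
  fixes x y z :: real
  assumes "0 \<le> x" "0 \<le> y" "0 \<le> z" "x + y + z = pi / 2"
  shows "rep ((sin x)\<^sup>2) ((sin y)\<^sup>2) ((sin z)\<^sup>2)"
proof -
  have right: "rep ((sin x)\<^sup>2) ((sin y)\<^sup>2) ((sin z)\<^sup>2)"
    if "z = pi / 2" "0 \<le> x" "0 \<le> y" "x + y + z = pi / 2" for x y z :: real
  proof -
    have "x = 0" "y = 0" using that by auto
    then show ?thesis using rep_degenerate[of 0 1] that(1) by (simp only: sin_zero sin_pi_half) simp
  qed
  consider "x = pi / 2" | "y = pi / 2" | "z = pi / 2"
    | "x < pi / 2" "y < pi / 2" "z < pi / 2"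
    using assms by linarith
  then show ?thesis
  proof cases
    case 1
    then show ?thesis using right[of y z x] assms
      by (intro rep_cyclic[of "(sin z)\<^sup>2"] rep_cyclic[of "(sin y)\<^sup>2"] right) auto
  next
    case 2
    then show ?thesis using assms
      by (intro rep_cyclic[of "(sin z)\<^sup>2"] right) auto
  next
    case 3
    then show ?thesis using right assms by blast
  next
    case 4
    have cos_pos: "0 < cos x" "0 < cos y" "0 < cos z"
      using 4 assms by (auto intro!: cos_gt_zero_pi)
    have sin_nn: "0 \<le> sin x" "0 \<le> sin y" "0 \<le> sin z"
      using 4 assms by (auto intro!: sin_ge_zero)
    have c: "cos z = sin x * cos y + cos x * sin y" if "x + y + z = pi / 2" for x y z :: real
    proof -
      have "z = pi / 2 - (x + y)" using that by simp
      then show ?thesis by (simp only: cos_diff cos_pi_half sin_pi_half sin_add) simp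
    qed
    have cz: "cos z = sin x * cos y + cos x * sin y"
      and cx: "cos x = sin y * cos z + cos y * sin z"
      and cy: "cos y = sin z * cos x + cos z * sin x"
      using assms by (auto intro: c)
    define u v w where "u = sin x * cos z / cos y" and "v = sin y * cos x / cos z"
      and "w = sin z * cos y / cos x"
    have u: "1 - u = sin z * cos x / cos y"
      and v: "1 - v = sin x * cos y / cos z" and w: "1 - w = sin y * cos z / cos x"
    proof -
      have "1 - u = (cos y - sin x * cos z) / cos y" "1 - v = (cos z - sin y * cos x) / cos z"
        "1 - w = (cos x - sin z * cos y) / cos x"
        unfolding u_def v_def w_def using cos_pos by (simp_all add: diff_divide_distrib)
      moreover have "cos y - sin x * cos z = sin z * cos x"
        "cos z - sin y * cos x = sin x * cos y" "cos x - sin z * cos y = sin y * cos z"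
        by (simp add: cy mult.commute, simp add: cz mult.commute, simp add: cx mult.commute)
      ultimately show "1 - u = sin z * cos x / cos y"
        "1 - v = sin x * cos y / cos z" "1 - w = sin y * cos z / cos x"
        by simp_all
    qed
    have "0 \<le> u" "0 \<le> v" "0 \<le> w"
      unfolding u_def v_def w_def using cos_pos sin_nn by auto
    moreover have "0 \<le> 1 - u" "0 \<le> 1 - v" "0 \<le> 1 - w"
      unfolding u v w using cos_pos sin_nn by auto
    moreover have "u * (1 - v) = (sin x)\<^sup>2" "v * (1 - w) = (sin y)\<^sup>2" "w * (1 - u) = (sin z)\<^sup>2"
      unfolding u v w unfolding u_def v_def w_def using cos_pos
      by (simp_all add: field_simps power2_eq_square)
    ultimately show ?thesis
      by (intro repI[of u v w]) auto
  qed
qed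

lemma rep_mono: "rep a b c \<Longrightarrow> a' \<le> a \<Longrightarrow> b' \<le> b \<Longrightarrow> c' \<le> c \<Longrightarrow> rep a' b' c'"
  unfolding rep_def by (meson order_trans)

text \<open>A product of shares is at most each of its factors, and any two corners divide one
  common edge; this bounds the pair sums.\<close>

lemma rep_le_1:
  assumes "rep a b c"
  shows "a \<le> 1" "b \<le> 1" "c \<le> 1" "a + b \<le> 1" "b + c \<le> 1" "c + a \<le> 1"
proof -
  obtain u v w where uvw: "u \<in> {0..1}" "v \<in> {0..1}" "w \<in> {0..1}"
    and a: "a \<le> u * (1 - v)" and b: "b \<le> v * (1 - w)" and c: "c \<le> w * (1 - u)"
    using assms unfolding rep_def by blast
  have m: "s * t \<le> s" "s * t \<le> t" if "s \<in> {0..1}" "t \<in> {0..1}" for s t :: real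
    using that by (auto intro: mult_left_le mult_left_le_one_le)
  have "a \<le> u" "a \<le> 1 - v" "b \<le> v" "b \<le> 1 - w" "c \<le> w" "c \<le> 1 - u"
    using m[of u "1 - v"] m[of v "1 - w"] m[of w "1 - u"] uvw a b c by auto
  then show "a \<le> 1" "b \<le> 1" "c \<le> 1" "a + b \<le> 1" "b + c \<le> 1" "c + a \<le> 1"
    using uvw by auto
qed

lemma cauchy_weights:
  fixes p q v :: real
  assumes "0 < v" "v < 1"
  shows "(p + q)\<^sup>2 \<le> p\<^sup>2 / (1 - v) + q\<^sup>2 / v"
proof -
  have "p\<^sup>2 / (1 - v) + q\<^sup>2 / v - (p + q)\<^sup>2 = (p * v - q * (1 - v))\<^sup>2 / (v * (1 - v))"
    using assms by (simp add: field_simps power2_eq_square)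
  also have "\<dots> \<ge> 0" using assms by simp
  finally show ?thesis by simp
qed

text \<open>For \<open>a = (sin x)^2\<close> and \<open>b = (sin y)^2\<close> with acute angles the
  left side is \<open>(sin (x + y))^2\<close>, so this is the algebraic core of the converse of
  \<open>rep_sin\<close>. The split \<open>v\<close> of the edge between the first two corners
  supplies the Cauchy-Schwarz weights, and the remaining slack factors into bounds on
  \<open>w\<close> and \<open>1 - u\<close>.\<close>

lemma rep_sqrt_bound:
  assumes "rep a b c" and nn: "0 \<le> a" "0 \<le> b" "0 \<le> c"
  shows "(sqrt (a * (1 - b)) + sqrt (b * (1 - a)))\<^sup>2 \<le> 1 - c"
proof -
  obtain u v w where uvw: "u \<in> {0..1}" "v \<in> {0..1}" "w \<in> {0..1}"
    and a: "a \<le> u * (1 - v)" and b: "b \<le> v * (1 - w)" and c: "c \<le> w * (1 - u)"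
    using assms(1) unfolding rep_def by blast
  note le = rep_le_1[OF assms(1)]
  \<comment> \<open>At the extreme values a Cauchy-Schwarz weight vanishes; then \<open>b\<close> or
    \<open>a\<close> is zero and a pair sum bound suffices.\<close>
  consider "v = 0" | "v = 1" | "0 < v" "v < 1" using uvw by fastforce
  then show ?thesis
  proof cases
    case 1
    then have "b = 0" using b nn by simp
    then show ?thesis using le nn by simp
  next
    case 2
    then have "a = 0" using a nn by simp
    then show ?thesis using le nn by simp
  next
    case 3
    have "(sqrt (a * (1 - b)) + sqrt (b * (1 - a)))\<^sup>2
        \<le> (sqrt (a * (1 - b)))\<^sup>2 / (1 - v) + (sqrt (b * (1 - a)))\<^sup>2 / v"
      using 3 by (rule cauchy_weights)
    also have "\<dots> = a * (1 - b) / (1 - v) + b * (1 - a) / v"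
      using nn le by simp
    also have "\<dots> = 1 - (1 - b / v) * (1 - a / (1 - v))"
      using 3 by (simp add: field_simps)
    also have "\<dots> \<le> 1 - c"
    proof -
      have "w \<le> 1 - b / v" "1 - u \<le> 1 - a / (1 - v)"
        using a b 3 by (simp_all add: field_simps)
      then have "w * (1 - u) \<le> (1 - b / v) * (1 - a / (1 - v))"
        using uvw by (intro mult_mono) auto
      then show ?thesis using c by simp
    qed
    finally show ?thesis .
  qed
qed

text \<open>In terms of angles, \<open>rep_sqrt_bound\<close> says that
  \<open>(sin (x + y))^2\<close> is at most \<open>(cos z)^2\<close>.\<close>

lemma rep_angles:
  assumes "rep a b c" and nn: "0 \<le> a" "0 \<le> b" "0 \<le> c"
  shows "arcsin (sqrt a) + arcsin (sqrt b) + arcsin (sqrt c) \<le> pi / 2"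
proof -
  note le = rep_le_1[OF assms(1)]
  define x y z where "x = arcsin (sqrt a)" and "y = arcsin (sqrt b)" and "z = arcsin (sqrt c)"
  have m: "-1 \<le> sqrt a" "-1 \<le> sqrt b" "-1 \<le> sqrt c"
    using nn by (simp_all add: real_sqrt_ge_zero add_increasing2 order_trans[of "-1" 0])
  have s: "sin x = sqrt a" "sin y = sqrt b" "sin z = sqrt c"
    unfolding x_def y_def z_def using le m by (simp_all add: sin_arcsin)
  have cs: "cos x = sqrt (1 - a)" "cos y = sqrt (1 - b)"
    unfolding x_def y_def using le nn m by (simp_all add: cos_arcsin)
  have r: "0 \<le> x" "x \<le> pi / 2" "0 \<le> y" "y \<le> pi / 2" "0 \<le> z" "z \<le> pi / 2"
    unfolding x_def y_def z_def using le nn m arcsin_bounded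
    by (auto intro!: arcsin_nonneg)
  have sin_co: "sin (pi / 2 - t) = cos t" for t :: real
    by (simp add: cos_sin_eq)
  have xy: "x + y \<le> pi / 2"
  proof -
    have "sin x \<le> sin (pi / 2 - y)"
      unfolding sin_co s cs using le by simp
    then show ?thesis using r sin_mono_le_eq[of x "pi / 2 - y"] by simp
  qed
  have "(sin (x + y))\<^sup>2 \<le> 1 - c"
    using rep_sqrt_bound[OF assms] by (simp add: sin_add s cs real_sqrt_mult mult.commute)
  then have "(sin z)\<^sup>2 \<le> (cos (x + y))\<^sup>2"
    using nn by (simp add: s cos_squared_eq)
  moreover have "0 \<le> cos (x + y)"
    using r xy by (intro cos_ge_zero) auto
  ultimately have "sin z \<le> sin (pi / 2 - (x + y))"
    unfolding sin_co by (rule power2_le_imp_le)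
  then have "z \<le> pi / 2 - (x + y)"
    using r xy sin_mono_le_eq[of z "pi / 2 - (x + y)"] by simp
  then show ?thesis unfolding x_def y_def z_def by simp
qed

section \<open>Supporting planes of the set of triples\<close>

text \<open>If the angle sum exceeded \<open>pi / 2\<close>, shrinking all angles by a common factor
  would reach the boundary surface and strictly lower the plane's linear form, although no boundary
  point lies below the plane.\<close>

lemma rep_below_tangent_plane:
  fixes a b c x y z k l m :: real
  assumes pos: "0 < k" "0 < l" "0 < m" and nn: "0 \<le> x" "0 \<le> y" "0 \<le> z"
    and tangent: "\<And>a b c. 0 \<le> a \<Longrightarrow> 0 \<le> b \<Longrightarrow> 0 \<le> c \<Longrightarrow> a + b + c = pi / 2 \<Longrightarrow>
      t \<le> k * (sin a)\<^sup>2 + l * (sin b)\<^sup>2 + m * (sin c)\<^sup>2"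
    and le: "k * x + l * y + m * z \<le> t"
  shows "rep x y z"
proof -
  have prods: "0 \<le> k * x" "0 \<le> l * y" "0 \<le> m * z" using pos nn by simp_all
  \<comment> \<open>The three extreme boundary points bound \<open>t\<close>; this forces the
    entries into the unit interval, where \<open>arcsin (sqrt s)\<close> is meaningful.\<close>
  have "t \<le> k" "t \<le> l" "t \<le> m"
    using tangent[of "pi / 2" 0 0] tangent[of 0 "pi / 2" 0] tangent[of 0 0 "pi / 2"] by simp_all
  then have "k * x \<le> k" "l * y \<le> l" "m * z \<le> m" using le prods by linarith+
  then have le1: "x \<le> 1" "y \<le> 1" "z \<le> 1" using pos by simp_all
  define f where "f = (\<lambda>s :: real. arcsin (sqrt s))"
  have f: "0 \<le> f s" "f s \<le> pi / 2" "(sin (f s))\<^sup>2 = s" if "0 \<le> s" "s \<le> 1" for s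
  proof -
    have "-1 \<le> sqrt s" using that by (simp add: order_trans[of "-1" 0])
    then show "0 \<le> f s" "f s \<le> pi / 2" "(sin (f s))\<^sup>2 = s"
      unfolding f_def using that arcsin_bounded by (auto intro: arcsin_nonneg simp: sin_arcsin)
  qed
  note fx = f[OF nn(1) le1(1)] and fy = f[OF nn(2) le1(2)] and fz = f[OF nn(3) le1(3)]
  define s where "s = f x + f y + f z"
  have "s \<le> pi / 2"
  proof (rule ccontr)
    assume "\<not> s \<le> pi / 2"
    define q where "q = pi / 2 / s"
    have s: "pi / 2 < s" "0 < s"
      using \<open>\<not> s \<le> pi / 2\<close> pi_gt_zero by linarith+
    then have q: "0 < q" "q < 1" "q * s = pi / 2"
      unfolding q_def by simp_all
    have shrink: "(sin (q * f r))\<^sup>2 \<le> r \<and> (f r > 0 \<longrightarrow> (sin (q * f r))\<^sup>2 < r)"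
      if r: "0 \<le> r" "r \<le> 1" for r
    proof (cases "f r = 0")
      case True
      then show ?thesis using r by simp
    next
      case False
      then have "0 < f r" using f(1)[OF r] by simp
      then have "0 \<le> q * f r" "q * f r < f r" using q by simp_all
      then have "sin (q * f r) < sin (f r)" "0 \<le> sin (q * f r)"
        using f(2)[OF r] by (auto intro!: sin_monotone_2pi sin_ge_zero)
      then have "(sin (q * f r))\<^sup>2 < (sin (f r))\<^sup>2"
        by (intro power_strict_mono) auto
      then show ?thesis using f(3)[OF r] by simp
    qed
    have "q * f x + q * f y + q * f z = pi / 2"
      using q(3) unfolding s_def by (simp add: algebra_simps)
    then have "t \<le> k * (sin (q * f x))\<^sup>2 + l * (sin (q * f y))\<^sup>2 + m * (sin (q * f z))\<^sup>2"
      using q(1) fx(1) fy(1) fz(1) by (intro tangent) auto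
    moreover have "k * (sin (q * f x))\<^sup>2 \<le> k * x" "l * (sin (q * f y))\<^sup>2 \<le> l * y"
      "m * (sin (q * f z))\<^sup>2 \<le> m * z"
      using shrink nn le1 pos by simp_all
    moreover have "k * (sin (q * f x))\<^sup>2 < k * x \<or> l * (sin (q * f y))\<^sup>2 < l * y \<or>
      m * (sin (q * f z))\<^sup>2 < m * z"
    proof -
      have "f x > 0 \<or> f y > 0 \<or> f z > 0"
        using s pi_gt_zero unfolding s_def by linarith
      then show ?thesis using shrink[of x] shrink[of y] shrink[of z] nn le1 pos by auto
    qed
    ultimately show False using le by linarith
  qed
  \<comment> \<open>The third angle is raised until the sum is exactly \<open>pi / 2\<close>, which
    only enlarges the third entry.\<close>
  then have "rep ((sin (f x))\<^sup>2) ((sin (f y))\<^sup>2) ((sin (pi / 2 - f x - f y))\<^sup>2)"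
    using fx fy fz unfolding s_def by (intro rep_sin) auto
  moreover have "(sin (f z))\<^sup>2 \<le> (sin (pi / 2 - f x - f y))\<^sup>2"
    using \<open>s \<le> pi / 2\<close> fx fy fz unfolding s_def
    by (intro power_mono sin_monotone_2pi_le sin_ge_zero) auto
  ultimately show ?thesis
    using fx(3) fy(3) fz(3) rep_mono by (metis order_refl)
qed

text \<open>The plane is stated for multipliers of the entries, with coefficients absorbing
  \<open>a\<close>, \<open>b\<close>, \<open>c\<close>, because fixing a variable multiplies
  probabilities by factors. The given triple corresponds to all multipliers being 1.\<close>

lemma rep_supporting_plane:
  assumes rep: "rep a b c" and nn: "0 \<le> a" "0 \<le> b" "0 \<le> c"
  obtains k l m where "0 \<le> k" "0 \<le> l" "0 \<le> m"
    "\<And>r s t. 0 \<le> r \<Longrightarrow> 0 \<le> s \<Longrightarrow> 0 \<le> t \<Longrightarrow> k * r + l * s + m * t \<le> k + l + m \<Longrightarrow>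
       rep (r * a) (s * b) (t * c)"
proof -
  note le = rep_le_1[OF rep]
  \<comment> \<open>With one entry zero the constraint is just that the other two sum to at most 1,
    which is already linear.\<close>
  have deg: "rep 0 (s * b) (t * c)"
    if "b + c \<le> 1" "0 \<le> b" "0 \<le> c" "0 \<le> s" "0 \<le> t" "0 * r + b * s + c * t \<le> 0 + b + c" for b c r s t
  proof -
    have "0 \<le> s * b" "0 \<le> t * c" "s * b + t * c \<le> b + c"
      using that by (simp_all add: mult.commute)
    then show ?thesis using that(1) by (intro rep_degenerate) linarith+
  qed
  consider "a = 0" | "b = 0" | "c = 0" | "0 < a" "0 < b" "0 < c" using nn by linarith
  then show ?thesis
  proof cases
    case 1
    then show ?thesis using deg[of b c] le nn by (intro that[of 0 b c]) auto
  next
    case 2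
    have "rep (r * a) (s * b) (t * c)" if "0 \<le> r" "0 \<le> s" "0 \<le> t" "a * r + 0 * s + c * t \<le> a + 0 + c" for r s t
      using deg[of c a t r] 2 that le nn rep_cyclic[of 0 "t * c" "r * a"] rep_cyclic[of "t * c" "r * a" 0] by simp
    then show ?thesis using nn by (intro that[of a 0 c]) auto
  next
    case 3
    have "rep (r * a) (s * b) (t * c)" if "0 \<le> r" "0 \<le> s" "0 \<le> t" "a * r + b * s + 0 * t \<le> a + b + 0" for r s t
      using deg[of a b r s] 3 that le nn rep_cyclic[of 0 "r * a" "s * b"] by simp
    then show ?thesis using nn by (intro that[of a b 0]) auto
  next
    case 4
    define x y where "x = arcsin (sqrt a)" and "y = arcsin (sqrt b)"
    \<comment> \<open>The triple may lie below the boundary; replacing the third angle by this one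
      moves it up to a boundary point, where the tangent plane is taken.\<close>
    define z where "z = pi / 2 - x - y"
    have s: "(sin x)\<^sup>2 = a" "(sin y)\<^sup>2 = b"
      unfolding x_def y_def using 4 le by (simp_all add: sin_arcsin order_trans[of "-1" 0])
    have p: "0 < x" "0 < y" "0 < arcsin (sqrt c)"
      using 4 le arcsin_less_arcsin[of 0] unfolding x_def y_def by force+
    have z: "arcsin (sqrt c) \<le> z"
      using rep_angles[OF rep nn] unfolding z_def x_def y_def by simp
    have "c = (sin (arcsin (sqrt c)))\<^sup>2"
      using 4 le by (simp add: sin_arcsin order_trans[of "-1" 0])
    also have "\<dots> \<le> (sin z)\<^sup>2"
      using z p unfolding z_def by (intro power_mono sin_monotone_2pi_le sin_ge_zero) auto
    finally have c: "c \<le> (sin z)\<^sup>2" .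
    have xyz: "x + y + z = pi / 2" and "0 < z" unfolding z_def[symmetric] using p z by (auto simp: z_def)
    then have pos: "0 < sin (2 * x)" "0 < sin (2 * y)" "0 < sin (2 * z)"
      using p by (auto intro!: sin_gt_zero)
    define k l m where "k = sin (2 * y) * sin (2 * z)" and "l = sin (2 * z) * sin (2 * x)"
      and "m = sin (2 * x) * sin (2 * y)"
    have klm: "0 < k" "0 < l" "0 < m" unfolding k_def l_def m_def using pos by simp_all
    show ?thesis
    proof (rule that[of "k * a" "l * b" "m * c"])
      fix r s t :: real
      assume rst: "0 \<le> r" "0 \<le> s" "0 \<le> t"
        and "k * a * r + l * b * s + m * c * t \<le> k * a + l * b + m * c"
      then have "k * (r * a) + l * (s * b) + m * (t * c) \<le> k * a + l * b + m * (sin z)\<^sup>2"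
        using mult_left_mono[OF c less_imp_le[OF klm(3)]] by (simp add: mult_ac)
      then show "rep (r * a) (s * b) (t * c)"
        using tangent_plane[OF xyz] rst nn klm s unfolding k_def l_def m_def
        by (intro rep_below_tangent_plane[of k l m _ _ _ "k * a + l * b + m * (sin z)\<^sup>2"])
           (auto simp: k_def l_def m_def)
    qed (use klm nn in auto)
  qed
qed

section \<open>Redistributing the edge weights around a variable\<close>

text \<open>\<open>\<phi> e f\<close> is the weight at the endpoint \<open>e\<close> of the edge
  between \<open>e\<close> and \<open>f\<close>. All pairs in \<open>A\<close> are constrained; in
  an affected set they are indeed pairwise adjacent.\<close>

definition edge_weights :: "'e set \<Rightarrow> ('e \<Rightarrow> 'e \<Rightarrow> real) \<Rightarrow> bool" where
  "edge_weights A \<phi> \<longleftrightarrow> (\<forall>e\<in>A. \<forall>f\<in>A - {e}. 0 \<le> \<phi> e f \<and> \<phi> e f + \<phi> f e \<le> 2)"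

lemma reweight_triple:
  fixes \<phi> :: "'e \<Rightarrow> 'e \<Rightarrow> real"
  assumes \<phi>: "edge_weights {d, e, f} \<phi>" and ne: "d \<noteq> e" "e \<noteq> f" "d \<noteq> f"
  obtains k l m :: real where "0 \<le> k" "0 \<le> l" "0 \<le> m"
    "\<And>r s t. 0 \<le> r \<Longrightarrow> 0 \<le> s \<Longrightarrow> 0 \<le> t \<Longrightarrow> k * r + l * s + m * t \<le> k + l + m \<Longrightarrow>
      \<exists>\<psi>. edge_weights {d, e, f} \<psi> \<and> r * (\<phi> d e * \<phi> d f) \<le> \<psi> d e * \<psi> d f \<and>
        s * (\<phi> e d * \<phi> e f) \<le> \<psi> e d * \<psi> e f \<and> t * (\<phi> f d * \<phi> f e) \<le> \<psi> f d * \<psi> f e"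
proof -
  have nn: "0 \<le> \<phi> d e" "0 \<le> \<phi> e d" "0 \<le> \<phi> e f" "0 \<le> \<phi> f e" "0 \<le> \<phi> f d" "0 \<le> \<phi> d f"
    and le: "\<phi> d e + \<phi> e d \<le> 2" "\<phi> e f + \<phi> f e \<le> 2" "\<phi> d f + \<phi> f d \<le> 2"
    using \<phi> ne unfolding edge_weights_def by auto
  define a b c where "a = \<phi> d e * \<phi> d f / 4" and "b = \<phi> e d * \<phi> e f / 4"
    and "c = \<phi> f d * \<phi> f e / 4"
  \<comment> \<open>Halved weights are shares of an edge. If the two weights sum to less than 2, one
    share is rounded up to the complement of the other.\<close>
  have half: "p * q / 4 \<le> p / 2 * (1 - q' / 2)" if "0 \<le> p" "q + q' \<le> 2" for p q q' :: real
    using mult_left_mono[of q "2 - q'" p] that by (simp add: field_simps)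
  have "rep a b c"
    using half[of "\<phi> d f" "\<phi> d e" "\<phi> e d"] half[of "\<phi> e d" "\<phi> e f" "\<phi> f e"]
      half[of "\<phi> f e" "\<phi> f d" "\<phi> d f"] nn le unfolding a_def b_def c_def
    by (intro repI[of "\<phi> d f / 2" "\<phi> e d / 2" "\<phi> f e / 2"]) (auto simp: mult.commute)
  moreover have "0 \<le> a" "0 \<le> b" "0 \<le> c" unfolding a_def b_def c_def using nn by simp_all
  ultimately obtain k l m where klm: "0 \<le> k" "0 \<le> l" "0 \<le> m" and
    *: "\<And>r s t. 0 \<le> r \<Longrightarrow> 0 \<le> s \<Longrightarrow> 0 \<le> t \<Longrightarrow> k * r + l * s + m * t \<le> k + l + m \<Longrightarrow>
      rep (r * a) (s * b) (t * c)"
    by (rule rep_supporting_plane) blast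
  show ?thesis
  proof (rule that[OF klm])
    fix r s t :: real
    assume rst: "0 \<le> r" "0 \<le> s" "0 \<le> t" "k * r + l * s + m * t \<le> k + l + m"
    obtain u v w where uvw: "u \<in> {0..1}" "v \<in> {0..1}" "w \<in> {0..1}"
      and le: "r * a \<le> u * (1 - v)" "s * b \<le> v * (1 - w)" "t * c \<le> w * (1 - u)"
      using *[OF rst] unfolding rep_def by blast
    \<comment> \<open>The splits \<open>u\<close>, \<open>v\<close>, \<open>w\<close> belong to the
      edges \<open>df\<close>, \<open>de\<close>, \<open>ef\<close>; doubling the shares gives
      weights that sum to exactly 2 on each edge.\<close>
    define \<psi> where "\<psi> = (\<lambda>g h. 2 * (if g = d then if h = f then u else 1 - v
      else if g = e then if h = d then v else 1 - w else if h = e then w else 1 - u))"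
    have "edge_weights {d, e, f} \<psi>"
      using uvw ne unfolding edge_weights_def \<psi>_def by auto
    moreover have "\<psi> d e * \<psi> d f = 4 * (u * (1 - v))" "\<psi> e d * \<psi> e f = 4 * (v * (1 - w))"
      "\<psi> f d * \<psi> f e = 4 * (w * (1 - u))"
      unfolding \<psi>_def using ne by auto
    ultimately show "\<exists>\<psi>. edge_weights {d, e, f} \<psi> \<and> r * (\<phi> d e * \<phi> d f) \<le> \<psi> d e * \<psi> d f \<and>
        s * (\<phi> e d * \<phi> e f) \<le> \<psi> e d * \<psi> e f \<and> t * (\<phi> f d * \<phi> f e) \<le> \<psi> f d * \<psi> f e"
      using le unfolding a_def b_def c_def by (intro exI[of _ \<psi>]) auto
  qed
qed

text \<open>One linear test with coefficients \<open>\<mu>\<close> certifies that the factors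
  \<open>r\<close> can be absorbed by new weights. Linearity lets the test pass through
  expectations.\<close>

lemma reweight:
  fixes \<phi> :: "'e \<Rightarrow> 'e \<Rightarrow> real"
  assumes fin: "finite A" and card: "card A \<le> 3" and \<phi>: "edge_weights A \<phi>"
  obtains \<mu> :: "'e \<Rightarrow> real" where "\<And>e. e \<in> A \<Longrightarrow> 0 \<le> \<mu> e"
    "\<And>r. (\<And>e. e \<in> A \<Longrightarrow> 0 \<le> r e) \<Longrightarrow> (\<Sum>e\<in>A. \<mu> e * r e) \<le> (\<Sum>e\<in>A. \<mu> e) \<Longrightarrow>
      \<exists>\<psi>. edge_weights A \<psi> \<and> (\<forall>e\<in>A. r e * (\<Prod>f\<in>A - {e}. \<phi> e f) \<le> (\<Prod>f\<in>A - {e}. \<psi> e f))"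
proof -
  have "card A \<in> {0, 1, 2, 3}" using card by auto
  then consider "A = {}" | e where "A = {e}" | e f where "A = {e, f}" "e \<noteq> f"
    | d e f where "A = {d, e, f}" "d \<noteq> e" "e \<noteq> f" "d \<noteq> f"
    using fin by (auto simp: card_1_singleton_iff card_2_iff card_3_iff)
  then show ?thesis
  proof cases
    case 1
    then show ?thesis using \<phi> by (intro that[of "\<lambda>_. 0"]) auto
  next
    case (2 e)
    then show ?thesis using \<phi> by (intro that[of "\<lambda>_. 1"]) auto
  next
    case (3 e f)
    have diff: "{e, f} - {e} = {f}" "{e, f} - {f} = {e}" using 3 by auto
    have nn: "0 \<le> \<phi> e f" "0 \<le> \<phi> f e" and le: "\<phi> e f + \<phi> f e \<le> 2"
      using \<phi> 3 unfolding edge_weights_def by auto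
    show ?thesis
    \<comment> \<open>On a single edge each weight is scaled by its factor. With the old weights as
      coefficients, the test says that the sum of the two weights does not grow.\<close>
    proof (rule that[of "\<lambda>g. if g = e then \<phi> e f else \<phi> f e"])
      fix r :: "'e \<Rightarrow> real"
      assume r: "\<And>e. e \<in> A \<Longrightarrow> 0 \<le> r e"
        and "(\<Sum>g\<in>A. (if g = e then \<phi> e f else \<phi> f e) * r g)
          \<le> (\<Sum>g\<in>A. if g = e then \<phi> e f else \<phi> f e)"
      then have "\<phi> e f * r e + \<phi> f e * r f \<le> 2" using 3 le by auto
      then show "\<exists>\<psi>. edge_weights A \<psi> \<and>
          (\<forall>e\<in>A. r e * (\<Prod>f\<in>A - {e}. \<phi> e f) \<le> (\<Prod>f\<in>A - {e}. \<psi> e f))"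
        using 3 nn r unfolding edge_weights_def
        by (intro exI[of _ "\<lambda>g h. r g * \<phi> g h"]) (auto simp: diff mult.commute)
    qed (use nn in auto)
  next
    case (4 d e f)
    have diff: "{d, e, f} - {d} = {e, f}" "{d, e, f} - {e} = {d, f}" "{d, e, f} - {f} = {d, e}"
      using 4 by auto
    obtain k l m where klm: "0 \<le> k" "0 \<le> l" "0 \<le> m" and
      *: "\<And>r s t. 0 \<le> r \<Longrightarrow> 0 \<le> s \<Longrightarrow> 0 \<le> t \<Longrightarrow> k * r + l * s + m * t \<le> k + l + m \<Longrightarrow>
      \<exists>\<psi>. edge_weights {d, e, f} \<psi> \<and> r * (\<phi> d e * \<phi> d f) \<le> \<psi> d e * \<psi> d f \<and>
        s * (\<phi> e d * \<phi> e f) \<le> \<psi> e d * \<psi> e f \<and> t * (\<phi> f d * \<phi> f e) \<le> \<psi> f d * \<psi> f e"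
      using reweight_triple[of d e f \<phi>] \<phi> 4 by blast
    show ?thesis
    proof (rule that[of "\<lambda>g. if g = d then k else if g = e then l else m"])
      fix r :: "'e \<Rightarrow> real"
      assume r: "\<And>e. e \<in> A \<Longrightarrow> 0 \<le> r e"
        and "(\<Sum>g\<in>A. (if g = d then k else if g = e then l else m) * r g)
          \<le> (\<Sum>g\<in>A. if g = d then k else if g = e then l else m)"
      then have "k * r d + l * r e + m * r f \<le> k + l + m" using 4 by (auto simp: add.assoc)
      then have "\<exists>\<psi>. edge_weights {d, e, f} \<psi> \<and> r d * (\<phi> d e * \<phi> d f) \<le> \<psi> d e * \<psi> d f \<and>
        r e * (\<phi> e d * \<phi> e f) \<le> \<psi> e d * \<psi> e f \<and> r f * (\<phi> f d * \<phi> f e) \<le> \<psi> f d * \<psi> f e"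
        using r 4 by (intro *) auto
      then show "\<exists>\<psi>. edge_weights A \<psi> \<and>
          (\<forall>e\<in>A. r e * (\<Prod>f\<in>A - {e}. \<phi> e f) \<le> (\<Prod>f\<in>A - {e}. \<psi> e f))"
        using 4 by (auto simp: diff)
    qed (use klm in auto)
  qed
qed

section \<open>Conditional probabilities of the bad events\<close>

text \<open>Conditioning is encoded by point masses for the fixed variables, so the joint law
  remains a product.\<close>

definition cond_law :: "('x, 'v, 'e) lll \<Rightarrow> ('x \<Rightarrow> 'v option) \<Rightarrow> 'x \<Rightarrow> 'v pmf" where
  "cond_law I \<rho> x = (case \<rho> x of None \<Rightarrow> dist I x | Some v \<Rightarrow> return_pmf v)"

text \<open>The product runs over the scope of \<open>e\<close> only, so that the quantity depends
  on visible data alone.\<close>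

definition event_cond_prob :: "('x, 'v, 'e) lll \<Rightarrow> ('x \<Rightarrow> 'v option) \<Rightarrow> 'e \<Rightarrow> real" where
  "event_cond_prob I \<rho> e =
     measure_pmf.prob (Pi_pmf (vbl I e) undefined (cond_law I \<rho>)) {\<sigma>. occurs I e \<sigma>}"

lemma event_cond_prob_nonneg [simp]: "0 \<le> event_cond_prob I \<rho> e"
  by (simp add: event_cond_prob_def)

lemma event_cond_prob_cong:
  assumes "vbl I e = vbl J e" "bad I e = bad J e"
    and "\<And>y. y \<in> vbl I e \<Longrightarrow> dist I y = dist J y" "\<And>y. y \<in> vbl I e \<Longrightarrow> \<rho> y = \<rho>' y"
  shows "event_cond_prob I \<rho> e = event_cond_prob J \<rho>' e"
proof -
  have "Pi_pmf (vbl I e) undefined (cond_law I \<rho>) = Pi_pmf (vbl J e) undefined (cond_law J \<rho>')"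
    using assms by (intro Pi_pmf_cong) (auto simp: cond_law_def split: option.split)
  then show ?thesis using assms(1,2) by (simp add: event_cond_prob_def occurs_def)
qed

lemma event_cond_prob_empty:
  assumes I: "lll_instance I" and e: "e \<in> events I"
  shows "event_cond_prob I Map.empty e = event_prob I e"
proof -
  have sub: "finite (vars I)" "vbl I e \<subseteq> vars I" using I e by (auto simp: lll_instance_def)
  have "restrict (\<lambda>x. if x \<in> vbl I e then \<sigma> x else undefined) (vbl I e) = restrict \<sigma> (vbl I e)"
    for \<sigma> :: "'a \<Rightarrow> 'b" by (auto simp: restrict_def)
  then show ?thesis
    unfolding event_cond_prob_def event_prob_def occurs_def
    by (simp add: cond_law_def[abs_def] Pi_pmf_subset[OF sub] vimage_def)
qed

lemma event_cond_prob_all_fixed: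
  assumes "lll_instance I" "e \<in> events I" and "\<And>x. x \<in> vbl I e \<Longrightarrow> \<rho> x = Some (\<sigma> x)"
  shows "event_cond_prob I \<rho> e = of_bool (occurs I e \<sigma>)"
proof -
  have fin: "finite (vbl I e)"
    using assms(1,2) by (auto simp: lll_instance_def intro: finite_subset)
  have "Pi_pmf (vbl I e) undefined (cond_law I \<rho>) =
      Pi_pmf (vbl I e) undefined (\<lambda>x. return_pmf (\<sigma> x))"
    using assms(3) by (intro Pi_pmf_cong) (auto simp: cond_law_def)
  also have "\<dots> = return_pmf (restrict \<sigma> (vbl I e))"
    using fin by (simp add: restrict_def)
  finally show ?thesis
    by (simp add: event_cond_prob_def occurs_def indicator_def)
qed

text \<open>Law of total probability over the value of \<open>x\<close>: its factor is split off the
  product, and the remaining factors do not depend on that value.\<close>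

lemma event_cond_prob_fix_variable:
  assumes I: "lll_instance I" and e: "e \<in> events I" and x: "x \<in> vbl I e" "\<rho> x = None"
  shows "(\<Sum>v\<in>set_pmf (dist I x). pmf (dist I x) v * event_cond_prob I (\<rho>(x \<mapsto> v)) e) = event_cond_prob I \<rho> e"
proof -
  define V where "V = vbl I e - {x}"
  have fin: "finite (set_pmf (dist I x))" "finite (vbl I e)"
    using I e x by (auto simp: lll_instance_def intro: finite_subset)
  have V: "vbl I e = insert x V" "finite V" "x \<notin> V" using x fin unfolding V_def by auto
  have rest: "Pi_pmf V undefined (cond_law I (\<rho>(x \<mapsto> v))) = Pi_pmf V undefined (cond_law I \<rho>)" for v
    using V(3) by (intro Pi_pmf_cong) (auto simp: cond_law_def)
  define Q where "Q v = Pi_pmf (vbl I e) undefined (cond_law I (\<rho>(x \<mapsto> v)))" for v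
  have "Pi_pmf (vbl I e) undefined (cond_law I \<rho>) = bind_pmf (dist I x) Q"
    unfolding Q_def V(1) Pi_pmf_insert'[OF V(2,3)] rest
    using x by (simp add: cond_law_def bind_return_pmf)
  moreover have "measure_pmf.prob (bind_pmf (dist I x) Q) {\<sigma>. occurs I e \<sigma>}
      = (\<Sum>v\<in>set_pmf (dist I x). pmf (dist I x) v * measure_pmf.prob (Q v) {\<sigma>. occurs I e \<sigma>})"
  proof -
    have "emeasure (bind_pmf (dist I x) Q) {\<sigma>. occurs I e \<sigma>}
        = (\<integral>\<^sup>+v. ennreal (measure_pmf.prob (Q v) {\<sigma>. occurs I e \<sigma>}) \<partial>dist I x)"
      unfolding emeasure_bind_pmf by (simp add: measure_pmf.emeasure_eq_measure)
    also have "\<dots> = ennreal (\<Sum>v\<in>set_pmf (dist I x).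
        measure_pmf.prob (Q v) {\<sigma>. occurs I e \<sigma>} * pmf (dist I x) v)"
      using fin(1) by (simp add: nn_integral_measure_pmf_finite flip: ennreal_mult sum_ennreal)
    finally show ?thesis
      by (simp add: measure_pmf.emeasure_eq_measure sum_nonneg mult.commute)
  qed
  ultimately show ?thesis unfolding event_cond_prob_def Q_def by simp
qed

lemma ex_le_of_average_le:
  fixes g :: "'a \<Rightarrow> real"
  assumes fin: "finite (set_pmf p)" and le: "(\<Sum>v\<in>set_pmf p. pmf p v * g v) \<le> t"
  shows "\<exists>v\<in>set_pmf p. g v \<le> t"
proof (rule ccontr)
  assume "\<not> (\<exists>v\<in>set_pmf p. g v \<le> t)"
  then have "(\<Sum>v\<in>set_pmf p. pmf p v * t) < (\<Sum>v\<in>set_pmf p. pmf p v * g v)"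
    using fin by (intro sum_strict_mono) (auto simp: set_pmf_not_empty pmf_positive not_le)
  moreover have "(\<Sum>v\<in>set_pmf p. pmf p v * t) = t"
    using fin by (simp add: sum_pmf_eq_1 flip: sum_distrib_right)
  ultimately show False using le by simp
qed

section \<open>The fixing process and its locality\<close>

text \<open>
  If the event has already become impossible, the ratio is \<open>0 / 0 = 0\<close>.
\<close>
definition admissible ::
  "('x, 'v, 'e) lll \<Rightarrow> ('x, 'v, 'e, 'e \<Rightarrow> real) state \<Rightarrow> 'x \<Rightarrow> 'v \<times> ('e \<Rightarrow> 'e \<Rightarrow> real) \<Rightarrow> bool" where
  "admissible I s x = (\<lambda>(v, \<psi>). v \<in> set_pmf (dist I x) \<and> edge_weights (affected I x) \<psi> \<and>
     (\<forall>e\<in>affected I x. (\<forall>f. f \<notin> affected I x \<longrightarrow> \<psi> e f = mem s e f) \<and>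
        event_cond_prob I ((val s)(x \<mapsto> v)) e / event_cond_prob I (val s) e *
          (\<Prod>f\<in>affected I x - {e}. mem s e f) \<le> (\<Prod>f\<in>affected I x - {e}. \<psi> e f)))"

text \<open>This isolates the data that a decision inspects; both halves of locality reduce to
  it.\<close>

lemma admissible_cong:
  assumes A: "affected I x = affected J x" and x: "dist I x = dist J x"
    and e: "\<And>e. e \<in> affected I x \<Longrightarrow> vbl I e = vbl J e"
      "\<And>e. e \<in> affected I x \<Longrightarrow> bad I e = bad J e"
      "\<And>e. e \<in> affected I x \<Longrightarrow> mem s e = mem t e"
    and y: "\<And>e y. e \<in> affected I x \<Longrightarrow> y \<in> vbl I e \<Longrightarrow> dist I y = dist J y"
      "\<And>e y. e \<in> affected I x \<Longrightarrow> y \<in> vbl I e \<Longrightarrow> val s y = val t y"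
  shows "admissible I s x = admissible J t x"
proof -
  have cp: "event_cond_prob I (val s) e = event_cond_prob J (val t) e"
    "event_cond_prob I ((val s)(x \<mapsto> v)) e = event_cond_prob J ((val t)(x \<mapsto> v)) e" if "e \<in> affected I x" for e v
    using that e y by (auto intro!: event_cond_prob_cong)
  show ?thesis
    unfolding admissible_def using cp e x unfolding A by (intro ext) (auto split: prod.splits)
qed

text \<open>For each affected event the probability ratio averages over the values of
  \<open>x\<close> to 1, or to 0 if the event is already impossible. Hence the linear test of
  \<open>reweight\<close> holds on average, and so for some value.\<close>

lemma admissible_exists:
  assumes I: "lll_instance I" and x: "x \<in> vars I" "val s x = None"
    and card: "card (affected I x) \<le> 3" and w: "edge_weights (affected I x) (mem s)"
  shows "\<exists>c. admissible I s x c"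
proof -
  define A where "A = affected I x"
  define r where "r v e = event_cond_prob I ((val s)(x \<mapsto> v)) e / event_cond_prob I (val s) e" for v e
  have fin: "finite A" "finite (set_pmf (dist I x))"
    using I x unfolding A_def affected_def lll_instance_def by auto
  obtain \<mu> where \<mu>: "\<And>e. e \<in> A \<Longrightarrow> 0 \<le> \<mu> e"
    and reweight: "\<And>r. (\<And>e. e \<in> A \<Longrightarrow> 0 \<le> r e) \<Longrightarrow> (\<Sum>e\<in>A. \<mu> e * r e) \<le> (\<Sum>e\<in>A. \<mu> e) \<Longrightarrow>
      \<exists>\<psi>. edge_weights A \<psi> \<and>
        (\<forall>e\<in>A. r e * (\<Prod>f\<in>A - {e}. mem s e f) \<le> (\<Prod>f\<in>A - {e}. \<psi> e f))"
    using reweight[OF fin(1) card[folded A_def] w[folded A_def]] by blast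
  have avg: "(\<Sum>v\<in>set_pmf (dist I x). pmf (dist I x) v * r v e) \<le> 1" if "e \<in> A" for e
  proof -
    have "(\<Sum>v\<in>set_pmf (dist I x). pmf (dist I x) v * r v e)
        = event_cond_prob I (val s) e / event_cond_prob I (val s) e"
      unfolding r_def using that x event_cond_prob_fix_variable[OF I, of e x "val s"]
      by (simp add: A_def affected_def flip: sum_divide_distrib)
    then show ?thesis by simp
  qed
  have "(\<Sum>v\<in>set_pmf (dist I x). pmf (dist I x) v * (\<Sum>e\<in>A. \<mu> e * r v e))
      = (\<Sum>e\<in>A. \<mu> e * (\<Sum>v\<in>set_pmf (dist I x). pmf (dist I x) v * r v e))"
    unfolding sum_distrib_left by (subst sum.swap) (simp add: mult_ac)
  also have "\<dots> \<le> (\<Sum>e\<in>A. \<mu> e * 1)"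
    using avg \<mu> by (intro sum_mono mult_left_mono) auto
  finally obtain v where v: "v \<in> set_pmf (dist I x)" "(\<Sum>e\<in>A. \<mu> e * r v e) \<le> (\<Sum>e\<in>A. \<mu> e)"
    using ex_le_of_average_le[OF fin(2)] by fastforce
  have "\<And>e. 0 \<le> r v e" by (simp add: r_def)
  then obtain \<psi> where \<psi>: "edge_weights A \<psi>"
    "\<And>e. e \<in> A \<Longrightarrow> r v e * (\<Prod>f\<in>A - {e}. mem s e f) \<le> (\<Prod>f\<in>A - {e}. \<psi> e f)"
    using reweight[of "r v"] v(2) by blast
  \<comment> \<open>\<open>reweight\<close> only controls weights inside \<open>A\<close>; the old
    ones are kept elsewhere, as admissibility demands.\<close>
  define \<psi>' where "\<psi>' e f = (if f \<in> A then \<psi> e f else mem s e f)" for e f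
  have "(\<Prod>f\<in>A - {e}. \<psi>' e f) = (\<Prod>f\<in>A - {e}. \<psi> e f)" for e
    by (intro prod.cong) (auto simp: \<psi>'_def)
  moreover have "edge_weights A \<psi>'"
    using \<psi>(1) unfolding edge_weights_def \<psi>'_def by auto
  moreover have "\<psi>' e f = mem s e f" if "f \<notin> A" for e f using that by (simp add: \<psi>'_def)
  ultimately have "admissible I s x (v, \<psi>')"
    using v(1) \<psi>(2) unfolding admissible_def A_def[symmetric] r_def by auto
  then show ?thesis ..
qed

text \<open>\<open>SOME\<close> is a function of the predicate alone, so equal admissibility
  predicates yield identical decisions.\<close>

definition fixing_process :: "('x, 'v, 'e, 'e \<Rightarrow> real) process" where
  "fixing_process = \<lparr>init = (\<lambda>_. 1), rule = (\<lambda>I s x. SOME c. admissible I s x c)\<rparr>"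

lemma rule_eqI: "admissible I s x = admissible J t x \<Longrightarrow>
    rule fixing_process I s x = rule fixing_process J t x"
  by (simp add: fixing_process_def)

lemma local_fixing_process: "local_process fixing_process"
  unfolding local_process_def
proof (intro conjI allI impI)
  fix I J :: "('a, 'b, 'c) lll" and s t :: "('a, 'b, 'c, 'c \<Rightarrow> real) state" and x
  assume eq: "view I s x = view J t x"
  define F X where "F = nbhd I x" and "X = insert x (\<Union>e\<in>F. vbl I e)"
  have F: "nbhd J x = F" using eq by (simp add: view_def Let_def F_def)
  have X: "insert x (\<Union>e\<in>F. vbl J e) = X" using eq F by (simp add: view_def Let_def F_def X_def)
  have eqs: "restrict (dist I) X = restrict (dist J) X" "restrict (vbl I) F = restrict (vbl J) F"
    "restrict (bad I) F = restrict (bad J) F" "val s |` X = val t |` X"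
    "restrict (mem s) F = restrict (mem t) F"
    using eq unfolding view_def Let_def F F_def[symmetric] X X_def[symmetric] by simp_all
  have vbl: "vbl I e = vbl J e" and bad: "bad I e = bad J e" and mem: "mem s e = mem t e"
    if "e \<in> F" for e
    using eqs that by (metis restrict_apply')+
  have dist: "dist I y = dist J y" and val: "val s y = val t y" if "y \<in> X" for y
    using eqs that by (metis restrict_apply' restrict_in)+
  \<comment> \<open>The view shows only events of the neighborhood, so the affected set has to be
    recovered from these.\<close>
  have aff: "affected K x = {e \<in> nbhd K x. x \<in> vbl K e}" for K :: "('a, 'b, 'c) lll"
    by (auto simp: nbhd_def affected_def neighbors_def)
  have AF: "affected I x \<subseteq> F" by (auto simp: F_def nbhd_def)
  have xX: "x \<in> X" by (simp add: X_def)
  have AX: "y \<in> X" if "e \<in> affected I x" "y \<in> vbl I e" for e y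
    using that AF by (auto simp: X_def)
  have "affected I x = affected J x"
    unfolding aff F F_def[symmetric] using vbl by auto
  then show "rule fixing_process I s x = rule fixing_process J t x"
    using AF vbl bad mem dist val xX AX by (intro rule_eqI admissible_cong) blast+
next
  fix I :: "('a, 'b, 'c) lll" and s :: "('a, 'b, 'c, 'c \<Rightarrow> real) state" and x y
  assume ne: "x \<noteq> y" and disj: "affected I x \<inter> affected I y = {}"
  obtain v m where c: "rule fixing_process I s y = (v, m)" by fastforce
  \<comment> \<open>Fixing \<open>y\<close> alters its value and the weights at its events. By
    disjointness, no event affected by \<open>x\<close> has \<open>y\<close> in its scope or has its
    weights altered.\<close>
  show "rule fixing_process I (step fixing_process I y s) x = rule fixing_process I s x"
    using disj unfolding step_def c
    by (intro rule_eqI admissible_cong) (auto simp: affected_def)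
qed

section \<open>Preservation of the invariant and correctness\<close>

definition invariant :: "('x, 'v, 'e) lll \<Rightarrow> ('x, 'v, 'e, 'e \<Rightarrow> real) state \<Rightarrow> bool" where
  "invariant I s \<longleftrightarrow>
     (\<forall>x v. val s x = Some v \<longrightarrow> v \<in> set_pmf (dist I x)) \<and>
     edge_weights (events I) (mem s) \<and>
     (\<forall>e\<in>events I. event_cond_prob I (val s) e \<le> event_prob I e * (\<Prod>f\<in>neighbors I e. mem s e f))"

lemma edge_weights_subset: "edge_weights B \<phi> \<Longrightarrow> A \<subseteq> B \<Longrightarrow> edge_weights A \<phi>"
  unfolding edge_weights_def by blast

lemma invariant_init: "lll_instance I \<Longrightarrow> invariant I (init_state fixing_process)"
  by (simp add: invariant_def init_state_def fixing_process_def edge_weights_def event_cond_prob_empty)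

lemma event_prob_nonneg [simp]: "0 \<le> event_prob I e"
  by (simp add: event_prob_def)

lemma invariant_step:
  assumes I: "lll_instance I" and x: "x \<in> vars I" "val s x = None"
    and card: "card (affected I x) \<le> 3" and inv: "invariant I s"
  shows "invariant I (step fixing_process I x s)"
proof -
  define A where "A = affected I x"
  have AE: "A \<subseteq> events I" by (auto simp: A_def affected_def)
  have w: "edge_weights (events I) (mem s)" using inv by (simp add: invariant_def)
  have "\<exists>c. admissible I s x c"
    using edge_weights_subset[OF w AE] by (intro admissible_exists[OF I x card]) (simp add: A_def)
  then have "admissible I s x (rule fixing_process I s x)"
    unfolding fixing_process_def by (simp add: someI_ex)
  moreover obtain v \<psi> where c: "rule fixing_process I s x = (v, \<psi>)" by fastforce
  ultimately have v: "v \<in> set_pmf (dist I x)" and \<psi>: "edge_weights A \<psi>"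
    and keep: "\<And>e f. e \<in> A \<Longrightarrow> f \<notin> A \<Longrightarrow> \<psi> e f = mem s e f"
    and ratio: "\<And>e. e \<in> A \<Longrightarrow> event_cond_prob I ((val s)(x \<mapsto> v)) e / event_cond_prob I (val s) e *
          (\<Prod>f\<in>A - {e}. mem s e f) \<le> (\<Prod>f\<in>A - {e}. \<psi> e f)"
    unfolding A_def by (simp_all add: admissible_def)
  define \<phi> where "\<phi> e = (if e \<in> A then \<psi> e else mem s e)" for e
  have step: "step fixing_process I x s = \<lparr>val = (val s)(x \<mapsto> v), mem = \<phi>\<rparr>"
    unfolding step_def c \<phi>_def A_def by auto
  have \<phi>: "edge_weights (events I) \<phi>"
    unfolding edge_weights_def
  proof (intro ballI)
    fix e f assume ef: "e \<in> events I" "f \<in> events I - {e}"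
    show "0 \<le> \<phi> e f \<and> \<phi> e f + \<phi> f e \<le> 2"
    proof (cases "e \<in> A \<and> f \<in> A")
      case True
      then show ?thesis using \<psi> ef unfolding edge_weights_def \<phi>_def by auto
    next
      case False
      \<comment> \<open>An edge with an endpoint outside \<open>A\<close> keeps both weights: the
        outer event is not updated, and the inner one keeps its weights towards the outside.\<close>
      then have "\<phi> e f = mem s e f" "\<phi> f e = mem s f e" using keep by (auto simp: \<phi>_def)
      then show ?thesis using w ef unfolding edge_weights_def by auto
    qed
  qed
  have "event_cond_prob I ((val s)(x \<mapsto> v)) e \<le> event_prob I e * (\<Prod>f\<in>neighbors I e. \<phi> e f)"
    if e: "e \<in> events I" for e
  proof (cases "e \<in> A")
    case False
    then have "event_cond_prob I ((val s)(x \<mapsto> v)) e = event_cond_prob I (val s) e"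
      using e by (intro event_cond_prob_cong) (auto simp: A_def affected_def)
    then show ?thesis using inv e False by (simp add: invariant_def \<phi>_def)
  next
    case True
    define q q' where "q = event_cond_prob I (val s) e" and "q' = event_cond_prob I ((val s)(x \<mapsto> v)) e"
    define N where "N = neighbors I e - A"
    \<comment> \<open>Events in \<open>A\<close> share \<open>x\<close>, so all of
      \<open>A - {e}\<close> are neighbors of \<open>e\<close>; only this part of the product
      changes.\<close>
    have N: "neighbors I e = (A - {e}) \<union> N" "finite N" "finite A" "(A - {e}) \<inter> N = {}"
      using True I unfolding N_def A_def affected_def neighbors_def lll_instance_def by auto
    have split: "(\<Prod>f\<in>neighbors I e. h f) = (\<Prod>f\<in>A - {e}. h f) * (\<Prod>f\<in>N. h f)" for h :: "_ \<Rightarrow> real"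
      unfolding N(1) using N by (intro prod.union_disjoint) auto
    have rest: "(\<Prod>f\<in>N. \<phi> e f) = (\<Prod>f\<in>N. mem s e f)"
      using True keep by (intro prod.cong) (auto simp: N_def \<phi>_def)
    have rest_nn: "0 \<le> (\<Prod>f\<in>N. mem s e f)"
      using w e by (intro prod_nonneg) (auto simp: N_def neighbors_def edge_weights_def)
    \<comment> \<open>An impossible event stays impossible for every value of positive probability.
      This justifies cancelling \<open>q\<close> below although division by zero yields 0.\<close>
    have zero: "q' = 0" if "q = 0"
    proof -
      have "(\<Sum>u\<in>set_pmf (dist I x). pmf (dist I x) u * event_cond_prob I ((val s)(x \<mapsto> u)) e) = 0"
        using event_cond_prob_fix_variable[OF I e] True x that by (simp add: q_def A_def affected_def)
      then have "pmf (dist I x) v * q' = 0"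
        using v I x unfolding q'_def
        by (subst (asm) sum_nonneg_eq_0_iff) (auto simp: lll_instance_def)
      then show ?thesis using v by (simp add: pmf_eq_0_set_pmf)
    qed
    have "q' = q' / q * q" using zero by auto
    also have "\<dots> \<le> q' / q * (event_prob I e * (\<Prod>f\<in>neighbors I e. mem s e f))"
      using inv e unfolding q_def q'_def invariant_def by (intro mult_left_mono) auto
    also have "\<dots> = event_prob I e * ((q' / q * (\<Prod>f\<in>A - {e}. mem s e f)) * (\<Prod>f\<in>N. mem s e f))"
      unfolding split by simp
    also have "\<dots> \<le> event_prob I e * ((\<Prod>f\<in>A - {e}. \<psi> e f) * (\<Prod>f\<in>N. mem s e f))"
      using ratio[OF True] rest_nn unfolding q_def q'_def
      by (intro mult_left_mono mult_right_mono) auto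
    also have "\<dots> = event_prob I e * (\<Prod>f\<in>neighbors I e. \<phi> e f)"
      unfolding split rest using True by (simp add: \<phi>_def)
    finally show ?thesis unfolding q'_def .
  qed
  then show ?thesis
    using inv v \<phi> unfolding step invariant_def by auto
qed

text \<open>The domain is tracked because each step requires its variable to be still
  unfixed.\<close>

lemma invariant_run:
  assumes I: "lll_instance I" and card: "\<forall>x\<in>vars I. card (affected I x) \<le> 3"
    and xs: "distinct xs" "set xs \<subseteq> vars I"
  shows "invariant I (run fixing_process I xs) \<and> dom (val (run fixing_process I xs)) = set xs"
  using xs
proof (induction xs rule: rev_induct)
  case Nil
  then show ?case using invariant_init[OF I] by (simp add: run_def) (simp add: init_state_def)
next
  case (snoc x xs)
  define s where "s = run fixing_process I xs"
  have s: "invariant I s" "dom (val s) = set xs" using snoc by (simp_all add: s_def)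
  have run: "run fixing_process I (xs @ [x]) = step fixing_process I x s"
    by (simp add: run_def s_def)
  have "val s x = None" using s(2) snoc.prems by auto
  then have "invariant I (step fixing_process I x s)"
    using I card s snoc.prems by (intro invariant_step) auto
  moreover have "dom (val (step fixing_process I x s)) = insert x (set xs)"
    using s(2) by (auto simp: step_def split: prod.splits)
  ultimately show ?case by (simp add: run)
qed

lemma solves_fixing_process:
  assumes I: "lll_instance I" and card: "\<forall>x\<in>vars I. card (affected I x) \<le> 3"
    and p: "\<forall>e\<in>events I. event_prob I e \<le> p" "p * 2 ^ max_degree I < 1"
  shows "solves fixing_process I"
  unfolding solves_def
proof (intro allI impI)
  fix xs assume xs: "distinct xs" "set xs = vars I"
  define s where "s = run fixing_process I xs"
  have inv: "invariant I s" and dom: "dom (val s) = vars I"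
    using invariant_run[OF I card, of xs] xs by (simp_all add: s_def)
  define \<sigma> where "\<sigma> x = the (val s x)" for x
  have \<sigma>: "val s x = Some (\<sigma> x)" if "x \<in> vars I" for x
    using that dom unfolding \<sigma>_def by (metis domIff option.collapse)
  have "\<not> occurs I e \<sigma>" if e: "e \<in> events I" for e
  proof
    assume "occurs I e \<sigma>"
    have "vbl I e \<subseteq> vars I" and fin: "finite (events I)" using I e by (auto simp: lll_instance_def)
    then have "1 = event_cond_prob I (val s) e"
      using event_cond_prob_all_fixed[OF I e] \<sigma> \<open>occurs I e \<sigma>\<close> by (simp add: subset_iff)
    also have "\<dots> \<le> event_prob I e * (\<Prod>f\<in>neighbors I e. mem s e f)"
      using inv e by (simp add: invariant_def)
    \<comment> \<open>A weight is at most 2 because the opposite weight on its edge is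
      nonnegative.\<close>
    also have "\<dots> \<le> event_prob I e * (\<Prod>f\<in>neighbors I e. 2)"
    proof (intro mult_left_mono prod_mono conjI)
      fix f assume "f \<in> neighbors I e"
      then have "0 \<le> mem s e f" "0 \<le> mem s f e" "mem s e f + mem s f e \<le> 2"
        using inv e unfolding invariant_def edge_weights_def neighbors_def by auto
      then show "0 \<le> mem s e f" "mem s e f \<le> 2" by auto
    qed simp
    also have "\<dots> \<le> event_prob I e * 2 ^ max_degree I"
    proof -
      have "card (neighbors I e) \<le> max_degree I"
        using fin e unfolding max_degree_def by (intro Max_ge) auto
      then show ?thesis by (auto intro!: mult_left_mono power_increasing)
    qed
    also have "\<dots> \<le> p * 2 ^ max_degree I"
      using p(1) e by (intro mult_right_mono) auto
    finally show False using p(2) by simp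
  qed
  then show "\<exists>\<sigma>. (\<forall>x\<in>vars I. val (run fixing_process I xs) x = Some (\<sigma> x) \<and> \<sigma> x \<in> set_pmf (dist I x)) \<and>
      (\<forall>e\<in>events I. \<not> occurs I e \<sigma>)"
    using \<sigma> inv unfolding s_def[symmetric] invariant_def by blast
qed

theorem theorem2:
  shows "\<exists>P :: ('x, 'v, 'e, 'e \<Rightarrow> real) process.
    local_process P \<and>
    (\<forall>I p. lll_instance I \<longrightarrow>
           (\<forall>x\<in>vars I. card (affected I x) \<le> 3) \<longrightarrow>
           (\<forall>e\<in>events I. event_prob I e \<le> p) \<longrightarrow>
           p * 2 ^ max_degree I < 1 \<longrightarrow>
           solves P I)"
  using local_fixing_process solves_fixing_process by blast

end
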